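(* Let $r>2$ and let $\{q_n\}_n$ be a sequence of positive real numbers with $q_n\downarrow 0$. If, for each $n$, $u_n:\mathbb{R}\to\mathbb{R}$ is a bounded solution to \[ u''''+q_nu''+|u|^{r-2}u=0, \] then $\|u_n\|_\infty\to 0$ as $n\to\infty$.
   Context: A solution is a $C^4$ function $u:\mathbb{R}\to\mathbb{R}$ satisfying the equation at every point of $\mathbb{R}$. $\|\cdot\|_\infty$ is the supremum norm on $\mathbb{R}$. *)

theory Defs
  imports "HOL-Analysis.Analysis"
begin

definition C_k_on_reals :: "nat \<Rightarrow> (real \<Rightarrow> real) \<Rightarrow> bool" where
  "C_k_on_reals k u \<longleftrightarrow>
     (\<forall>j<k. \<forall>x. (deriv ^^ j) u field_differentiable at x) \<and>
     continuous_on UNIV ((deriv ^^ k) u)"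

text \<open>At zeros of \<open>u\<close> the nonlinearity is \<open>0\<close>, since \<open>\<bar>u x\<bar> powr (r - 2)\<close> is multiplied
  by \<open>u x = 0\<close>; for \<open>r > 2\<close> this is the usual reading of \<open>\<bar>u\<bar>\<^sup>r\<^sup>-\<^sup>2 u\<close>.\<close>

definition is_solution :: "real \<Rightarrow> real \<Rightarrow> (real \<Rightarrow> real) \<Rightarrow> bool" where
  "is_solution r q u \<longleftrightarrow>
     C_k_on_reals 4 u \<and>
     (\<forall>x. (deriv ^^ 4) u x + q * (deriv ^^ 2) u x + \<bar>u x\<bar> powr (r - 2) * u x = 0)"

text \<open>The supremum is taken in the conditionally complete lattice of the reals, so this is the
  supremum norm only for bounded \<open>u\<close>.\<close>

definition sup_norm :: "(real \<Rightarrow> real) \<Rightarrow> real" where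
  "sup_norm u = (SUP x. \<bar>u x\<bar>)"

end

theory Submission
  imports Defs
begin

text \<open>
  For a solution \<open>v\<close>, the function \<open>G = v v'' - v'\<^sup>2\<close> satisfies
  \<open>G'' = v v'''' - v''\<^sup>2 = - q v v'' - v''\<^sup>2 - \<bar>v\<bar>\<^sup>r \<le> q\<^sup>2 v\<^sup>2 / 4 - \<bar>v\<bar>\<^sup>r\<close>, so for \<open>q = 0\<close> it
  is concave, and a bounded concave function on the line is constant. For a solution with
  \<open>\<parallel>v\<parallel>\<^sub>\<infinity> = 1\<close> and \<open>q \<le> 1\<close> the function \<open>G\<close> is bounded by an absolute constant, and \<open>G''\<close> is
  uniformly negative on an interval of fixed length; this is incompatible with \<open>G'' \<le> q\<^sup>2 / 4\<close>
  unless \<open>q \<ge> p\<close> for some \<open>p > 0\<close> depending only on \<open>r\<close>. The rescaling \<open>v x = u (\<lambda> x) / M\<close> with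
  \<open>M = \<parallel>u\<parallel>\<^sub>\<infinity>\<close> and \<open>\<lambda>\<^sup>4 M\<^sup>r\<^sup>-\<^sup>2 = 1\<close> turns \<open>q\<close> into \<open>q \<lambda>\<^sup>2\<close>, whence \<open>M\<^sup>(\<^sup>r\<^sup>-\<^sup>2\<^sup>)\<^sup>/\<^sup>2 \<le> q / p\<close>.
\<close>

section \<open>Derivative bounds for bounded functions\<close>

lemma mvt_real:
  fixes f f' :: "real \<Rightarrow> real"
  assumes "\<And>x. (f has_real_derivative f' x) (at x)" and "a < b"
  obtains z where "a < z" "z < b" "f b - f a = (b - a) * f' z"
  using MVT2[OF assms(2), of f f'] assms(1) by blast

lemma deriv_small_between:
  fixes f f' :: "real \<Rightarrow> real"
  assumes f: "\<And>x. (f has_real_derivative f' x) (at x)"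
    and "\<And>x. \<bar>f x\<bar> \<le> 1"
  obtains z where "a < z" "z < a + 1" "\<bar>f' z\<bar> \<le> 2"
proof -
  obtain z where z: "a < z" "z < a + 1" "f (a + 1) - f a = (a + 1 - a) * f' z"
    using mvt_real[OF f, of a "a + 1"] by auto
  have "\<bar>f' z\<bar> \<le> 2"
    using z(3) assms(2)[of a] assms(2)[of "a + 1"] by simp
  with z that show ?thesis by blast
qed

text \<open>The outer two of the three unit intervals each contain a point of slope at most 2. These
  points are more than 1 apart, so the mean second derivative between them is at most 4.\<close>

lemma second_deriv_small_between:
  fixes f f' f'' :: "real \<Rightarrow> real"
  assumes f: "\<And>x. (f has_real_derivative f' x) (at x)"
    and f': "\<And>x. (f' has_real_derivative f'' x) (at x)"
    and bd: "\<And>x. \<bar>f x\<bar> \<le> 1"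
  obtains z where "a < z" "z < a + 3" "\<bar>f'' z\<bar> \<le> 4"
proof -
  obtain s where s: "a < s" "s < a + 1" "\<bar>f' s\<bar> \<le> 2"
    using deriv_small_between[OF f bd] .
  obtain t where t: "a + 2 < t" "t < a + 2 + 1" "\<bar>f' t\<bar> \<le> 2"
    using deriv_small_between[OF f bd] .
  have "s < t" using s t by simp
  then obtain z where z: "s < z" "z < t" "f' t - f' s = (t - s) * f'' z"
    using mvt_real[OF f'] by metis
  have "1 * \<bar>f'' z\<bar> \<le> (t - s) * \<bar>f'' z\<bar>"
    using s t by (intro mult_right_mono) auto
  also have "\<dots> = \<bar>f' t - f' s\<bar>"
    using z \<open>s < t\<close> by (simp add: abs_mult)
  also have "\<dots> \<le> 4" using s t by simp
  finally have "\<bar>f'' z\<bar> \<le> 4" by simp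
  with z s t that[of z] show ?thesis by simp
qed

text \<open>A value above 23 forces a rise of more than 18 within distance 3, hence a slope above 6,
  and then likewise a slope below -6. Such a drop of more than 12 over a length below 6 contradicts
  \<open>\<bar>w''\<bar> \<le> 1\<close>.\<close>

lemma bound_by_surrounding_points:
  fixes w w' w'' :: "real \<Rightarrow> real"
  assumes w: "\<And>x. (w has_real_derivative w' x) (at x)"
    and w': "\<And>x. (w' has_real_derivative w'' x) (at x)"
    and bd: "\<And>x. \<bar>w'' x\<bar> \<le> 1"
    and ab: "x - 3 < a" "a < x" "x < b" "b < x + 3"
    and "w a \<le> 5" "w b \<le> 5"
  shows "w x \<le> 23"
proof (rule ccontr)
  assume "\<not> w x \<le> 23"
  then have big: "w x > 23" by simp
  obtain s where s: "a < s" "s < x" "w x - w a = (x - a) * w' s"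
    using mvt_real[OF w \<open>a < x\<close>] .
  obtain t where t: "x < t" "t < b" "w b - w x = (b - x) * w' t"
    using mvt_real[OF w \<open>x < b\<close>] .
  have "w' s > 6"
  proof (rule ccontr)
    assume "\<not> w' s > 6"
    then have "(x - a) * w' s \<le> (x - a) * 6" using ab by (intro mult_left_mono) auto
    then show False using s big ab assms by simp
  qed
  moreover have "w' t < -6"
  proof (rule ccontr)
    assume "\<not> w' t < -6"
    then have "(b - x) * w' t \<ge> (b - x) * (-6)" using ab by (intro mult_left_mono) auto
    then show False using t big ab assms by simp
  qed
  moreover have "s < t" using s t by simp
  then obtain z where z: "w' t - w' s = (t - s) * w'' z"
    using mvt_real[OF w'] by metis
  have "(t - s) * w'' z \<ge> (t - s) * (-1)"
    using bd[of z] \<open>s < t\<close> by (intro mult_left_mono) auto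
  ultimately show False using z s t ab by simp
qed

text \<open>The hypothesis controls no single derivative, but \<open>v4 + p * v2\<close> is the
  second derivative of \<open>w = v2 + p * v\<close>. Near every point, on both sides,
  \<open>v2\<close> is at most 4 in modulus and so \<open>w\<close> at most 5; this bounds
  \<open>w\<close>, then \<open>v2\<close>, then \<open>v1\<close>.\<close>

lemma derivs_bounded:
  fixes v v1 v2 v3 v4 :: "real \<Rightarrow> real"
  assumes d: "\<And>x. (v has_real_derivative v1 x) (at x)"
    "\<And>x. (v1 has_real_derivative v2 x) (at x)"
    "\<And>x. (v2 has_real_derivative v3 x) (at x)"
    "\<And>x. (v3 has_real_derivative v4 x) (at x)"
    and p: "0 < p" "p \<le> 1"
    and bd: "\<And>x. \<bar>v x\<bar> \<le> 1" and bd4: "\<And>x. \<bar>v4 x + p * v2 x\<bar> \<le> 1"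
  shows "\<bar>v2 x\<bar> \<le> 24" "\<bar>v1 x\<bar> \<le> 26"
proof -
  define w where "w = (\<lambda>x. v2 x + p * v x)"
  define w' where "w' = (\<lambda>x. v3 x + p * v1 x)"
  define w'' where "w'' = (\<lambda>x. v4 x + p * v2 x)"
  have w: "(w has_real_derivative w' x) (at x)" for x
    unfolding w_def w'_def by (auto intro!: derivative_eq_intros d)
  have w': "(w' has_real_derivative w'' x) (at x)" for x
    unfolding w'_def w''_def by (auto intro!: derivative_eq_intros d)
  have pv: "\<bar>p * v x\<bar> \<le> 1" for x
    using mult_mono[OF p(2) bd[of x]] p by (simp add: abs_mult)
  have v2: "\<bar>v2 x\<bar> \<le> 24" for x
  proof -
    obtain a where a: "x - 3 < a" "a < x - 3 + 3" "\<bar>v2 a\<bar> \<le> 4"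
      using second_deriv_small_between[OF d(1,2) bd] .
    obtain b where b: "x < b" "b < x + 3" "\<bar>v2 b\<bar> \<le> 4"
      using second_deriv_small_between[OF d(1,2) bd] .
    have wab: "\<bar>w a\<bar> \<le> 5" "\<bar>w b\<bar> \<le> 5"
      using a b pv[of a] pv[of b] by (auto simp: w_def)
    have "w x \<le> 23"
      by (rule bound_by_surrounding_points[OF w w', of x a b])
        (use a b wab bd4 in \<open>auto simp: w''_def\<close>)
    moreover have "- w x \<le> 23"
      by (rule bound_by_surrounding_points[of "\<lambda>x. - w x" "\<lambda>x. - w' x" "\<lambda>x. - w'' x" x a b])
        (use a b wab bd4 in \<open>auto simp: w''_def intro!: DERIV_minus w w'[unfolded w''_def]
            simp del: minus_add_distrib\<close>)
    ultimately show ?thesis using pv[of x] by (simp add: w_def)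
  qed
  show "\<bar>v2 x\<bar> \<le> 24" by (rule v2)
  obtain s where s: "x < s" "s < x + 1" "\<bar>v1 s\<bar> \<le> 2"
    using deriv_small_between[OF d(1) bd] .
  obtain z where z: "v1 s - v1 x = (s - x) * v2 z"
    using mvt_real[OF d(2) s(1)] by metis
  have "\<bar>(s - x) * v2 z\<bar> \<le> 1 * 24"
    unfolding abs_mult using s v2[of z] by (intro mult_mono) auto
  then show "\<bar>v1 x\<bar> \<le> 26" using z s by simp
qed

section \<open>Almost concave functions and the lower bound for the parameter\<close>

text \<open>Across the dip the slope falls by at least \<open>2 * c * h\<close>, so at one end
  \<open>G\<close> descends away from \<open>a\<close> at rate at least \<open>c * h\<close>. If
  \<open>e * L\<close> were at most \<open>c * h / 2\<close>, a rate of \<open>c * h / 2\<close>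
  would persist over length \<open>L\<close>, and \<open>G\<close> would change by more than
  \<open>2 * K\<close>.\<close>

lemma bounded_almost_concave:
  fixes G G1 G2 :: "real \<Rightarrow> real"
  assumes G: "\<And>x. (G has_real_derivative G1 x) (at x)"
    and G1: "\<And>x. (G1 has_real_derivative G2 x) (at x)"
    and K: "\<And>x. \<bar>G x\<bar> \<le> K"
    and c: "c > 0" and h: "h > 0"
    and dip: "\<And>x. \<bar>x - a\<bar> \<le> h \<Longrightarrow> G2 x \<le> - c"
    and e: "\<And>x. G2 x \<le> e" "e \<ge> 0"
  defines "L \<equiv> 4 * K / (c * h) + 1"
  shows "e * L > c * h / 2"
proof (rule ccontr)
  assume neg: "\<not> e * L > c * h / 2"
  have ch: "c * h > 0" using c h by simp
  have "K \<ge> 0" using K[of 0] by simp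
  then have L: "L > 0" using ch unfolding L_def by (simp add: add_nonneg_pos)
  have KL: "2 * K < (c * h / 2) * L"
    using ch c h unfolding L_def by (simp add: field_simps)
  have slope: "G1 y - G1 x \<le> c * h / 2" if "x < y" "y - x \<le> L" for x y
  proof -
    obtain z where z: "G1 y - G1 x = (y - x) * G2 z"
      using mvt_real[OF G1 \<open>x < y\<close>] by metis
    have "(y - x) * G2 z \<le> L * e"
      using that e by (meson L diff_gt_0_iff_gt less_imp_le mult_left_mono mult_right_mono order_trans)
    then show ?thesis using z neg by (simp add: mult.commute)
  qed
  have "a - h < a + h" using h by simp
  then obtain z where z: "a - h < z" "z < a + h" "G1 (a + h) - G1 (a - h) = (a + h - (a - h)) * G2 z"
    using mvt_real[OF G1] by metis
  have "(2 * h) * G2 z \<le> (2 * h) * (- c)"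
    using dip[of z] z h by (intro mult_left_mono) auto
  then have "G1 (a + h) \<le> - (c * h) \<or> G1 (a - h) \<ge> c * h"
    using z(3) by (auto simp: algebra_simps)
  then show False
  proof
    assume A: "G1 (a + h) \<le> - (c * h)"
    obtain y where y: "a + h < y" "y < a + h + L" "G (a + h + L) - G (a + h) = (a + h + L - (a + h)) * G1 y"
      using mvt_real[OF G, of "a + h" "a + h + L"] L by auto
    have "G1 y \<le> - (c * h / 2)" using slope[OF y(1)] y A by simp
    then have "L * G1 y \<le> L * (- (c * h / 2))" using L by (intro mult_left_mono) auto
    then show False
      using y(3) KL K[of "a + h"] K[of "a + h + L"] by (simp add: mult.commute)
  next
    assume A: "G1 (a - h) \<ge> c * h"
    obtain y where y: "a - h - L < y" "y < a - h" "G (a - h) - G (a - h - L) = (a - h - (a - h - L)) * G1 y"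
      using mvt_real[OF G, of "a - h - L" "a - h"] L by auto
    have "G1 y \<ge> c * h / 2" using slope[OF y(2)] y A by simp
    then have "L * G1 y \<ge> L * (c * h / 2)" using L by (intro mult_left_mono) auto
    then show False
      using y(3) KL K[of "a - h"] K[of "a - h - L"] by (simp add: mult.commute)
  qed
qed

lemma normalized_solution_parameter_bound:
  fixes r :: real
  assumes "r > 2"
  obtains p0 where "p0 > 0"
    "\<And>p v v1 v2 v3 v4 a. \<lbrakk>\<And>x. (v has_real_derivative v1 x) (at x);
       \<And>x. (v1 has_real_derivative v2 x) (at x);
       \<And>x. (v2 has_real_derivative v3 x) (at x);
       \<And>x. (v3 has_real_derivative v4 x) (at x);
       \<And>x. v4 x + p * v2 x + \<bar>v x\<bar> powr (r - 2) * v x = 0;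
       \<And>x. \<bar>v x\<bar> \<le> 1; \<bar>v a\<bar> \<ge> 1 / 2; p > 0\<rbrakk> \<Longrightarrow> p \<ge> p0"
proof
  \<comment> \<open>Since \<open>\<bar>v1\<bar> \<le> 26\<close>, \<open>v\<close> keeps modulus at
    least 1/4 within \<open>h = 1/104\<close> of \<open>a\<close>, where
    \<open>\<bar>v\<bar>\<close> to the power \<open>r\<close> is then at least
    \<open>2 * c\<close>. The bound 700 for \<open>G\<close> is 24 + 26^2.\<close>
  define c where "c = (1 / 4) powr (r - 2) / 32"
  define h :: real where "h = 1 / 104"
  define L where "L = 4 * 700 / (c * h) + 1"
  define p0 where "p0 = min 1 (min c (c * h / L))"
  have c: "c > 0" and h: "h > 0" by (auto simp: c_def h_def)
  then have L: "L > 0" by (simp add: L_def add_pos_pos)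
  show "p0 > 0" using c h L by (simp add: p0_def)
  fix p a and v v1 v2 v3 v4 :: "real \<Rightarrow> real"
  assume d: "\<And>x. (v has_real_derivative v1 x) (at x)"
    "\<And>x. (v1 has_real_derivative v2 x) (at x)"
    "\<And>x. (v2 has_real_derivative v3 x) (at x)"
    "\<And>x. (v3 has_real_derivative v4 x) (at x)"
    and eq: "\<And>x. v4 x + p * v2 x + \<bar>v x\<bar> powr (r - 2) * v x = 0"
    and bd: "\<And>x. \<bar>v x\<bar> \<le> 1" and a: "\<bar>v a\<bar> \<ge> 1 / 2" and p: "p > 0"
  show "p \<ge> p0"
  proof (rule ccontr)
    assume "\<not> p \<ge> p0"
    then have ps: "p \<le> 1" "p \<le> c" "p \<le> c * h / L" by (auto simp: p0_def)
    have bd4: "\<bar>v4 x + p * v2 x\<bar> \<le> 1" for x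
    proof -
      have "\<bar>v x\<bar> powr (r - 2) * \<bar>v x\<bar> \<le> 1 * 1"
        using bd[of x] assms by (intro mult_mono powr_le1) auto
      moreover have "v4 x + p * v2 x = - (\<bar>v x\<bar> powr (r - 2) * v x)" using eq[of x] by simp
      ultimately show ?thesis by (simp add: abs_mult)
    qed
    note b = derivs_bounded[OF d p ps(1) bd bd4]
    define G where "G = (\<lambda>x. v x * v2 x - v1 x ^ 2)"
    define G1 where "G1 = (\<lambda>x. v x * v3 x - v1 x * v2 x)"
    define G2 where "G2 = (\<lambda>x. v x * v4 x - v2 x ^ 2)"
    have G: "(G has_real_derivative G1 x) (at x)" for x
      unfolding G_def G1_def by (auto intro!: derivative_eq_intros d simp: algebra_simps)
    have G1: "(G1 has_real_derivative G2 x) (at x)" for x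
      unfolding G1_def G2_def
      by (auto intro!: derivative_eq_intros d simp: algebra_simps power2_eq_square)
    have K: "\<bar>G x\<bar> \<le> 700" for x
    proof -
      have "\<bar>v x * v2 x\<bar> \<le> 1 * 24"
        unfolding abs_mult using bd[of x] b(1)[of x] by (intro mult_mono) auto
      moreover have "v1 x ^ 2 \<le> 676"
        using power_mono[OF b(2)[of x], of 2] by simp
      ultimately show ?thesis
        using zero_le_power2[of "v1 x"] unfolding G_def by linarith
    qed
    have G2: "G2 x \<le> p / 4 - \<bar>v x\<bar> powr (r - 2) * v x ^ 2" for x
    proof -
      have v4: "v4 x = - p * v2 x - \<bar>v x\<bar> powr (r - 2) * v x" using eq[of x] by simp
      \<comment> \<open>Completing the square in \<open>v2\<close> removes the mixed term
        \<open>- p * v * v2\<close>, whose sign is unknown.\<close>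
      have "G2 x = (p * v x)^2 / 4 - (v2 x + p * v x / 2) ^ 2 - \<bar>v x\<bar> powr (r - 2) * v x ^ 2"
        unfolding G2_def v4 by (simp add: power2_eq_square algebra_simps)
      moreover have "(p * v x)^2 \<le> p"
      proof -
        have "p * p * (v x)^2 \<le> p * 1 * 1"
          using ps(1) p bd[of x] abs_square_le_1[of "v x"] by (intro mult_mono) auto
        then show ?thesis by (simp add: power2_eq_square algebra_simps)
      qed
      ultimately show ?thesis using zero_le_power2[of "v2 x + p * v x / 2"] by linarith
    qed
    have e: "G2 x \<le> p / 4" for x
    proof -
      have "\<bar>v x\<bar> powr (r - 2) * v x ^ 2 \<ge> 0" by simp
      then show ?thesis using G2[of x] by linarith
    qed
    have dip: "G2 x \<le> - c" if x: "\<bar>x - a\<bar> \<le> h" for x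
    proof -
      have "norm (v x - v a) \<le> 26 * norm (x - a)"
        by (rule field_differentiable_bound[of UNIV v v1]) (use d b(2) in auto)
      then have "\<bar>v x\<bar> \<ge> 1 / 4" using a x by (simp add: h_def)
      moreover from this have "\<bar>v x\<bar> ^ 2 \<ge> (1 / 4) ^ 2" by (intro power_mono) auto
      ultimately have "\<bar>v x\<bar> powr (r - 2) * v x ^ 2 \<ge> (1 / 4) powr (r - 2) * (1 / 4) ^ 2"
        using assms by (intro mult_mono powr_mono2) auto
      then have "\<bar>v x\<bar> powr (r - 2) * v x ^ 2 \<ge> 2 * c" by (simp add: c_def power2_eq_square)
      then show ?thesis using G2[of x] ps(2) p c by linarith
    qed
    have "(p / 4) * (4 * 700 / (c * h) + 1) > c * h / 2"
      by (rule bounded_almost_concave[OF G G1 K c h dip e]) (use p in auto)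
    then have "p * L > 2 * (c * h)" by (simp add: L_def)
    moreover have "p * L \<le> c * h" using ps(3) L by (simp add: field_simps)
    ultimately show False using c h mult_pos_pos[of c h] by linarith
  qed
qed

section \<open>Rescaling and decay of the supremum norm\<close>

lemma solution_derivs:
  assumes "is_solution r q u" and "j < 4"
  shows "((deriv ^^ j) u has_real_derivative (deriv ^^ Suc j) u x) (at x)"
  using assms by (auto simp: is_solution_def C_k_on_reals_def field_differentiable_derivI)

lemma abs_le_sup_norm:
  assumes "bounded (range u)"
  shows "\<bar>u x\<bar> \<le> sup_norm u"
  unfolding sup_norm_def
proof (rule cSUP_upper)
  show "bdd_above (range (\<lambda>x. \<bar>u x\<bar>))"
    using assms by (auto simp: bounded_iff bdd_above_def)
qed simp

lemma sup_norm_nonneg: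
  assumes "bounded (range u)"
  shows "0 \<le> sup_norm u"
  using abs_le_sup_norm[OF assms, of 0] by simp

text \<open>The supremum over the line may not be attained, which is why the normalized estimate
  only asks for a point with \<open>\<bar>v a\<bar> \<ge> 1 / 2\<close>.\<close>

lemma half_sup_norm_attained:
  assumes "sup_norm u > 0"
  obtains x where "\<bar>u x\<bar> \<ge> sup_norm u / 2"
proof (rule ccontr)
  assume "\<not> thesis"
  then have "\<bar>u x\<bar> \<le> sup_norm u / 2" for x using that by (meson linear)
  then have "sup_norm u \<le> sup_norm u / 2"
    unfolding sup_norm_def[of u, symmetric] by (subst sup_norm_def) (intro cSUP_least, auto)
  then show False using assms by simp
qed

lemma sup_norm_solution_bound:
  fixes r :: real
  assumes r: "r > 2"
  obtains p0 where "p0 > 0"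
    "\<And>q u. is_solution r q u \<Longrightarrow> bounded (range u) \<Longrightarrow> q > 0 \<Longrightarrow>
       sup_norm u \<le> (q / p0) powr (2 / (r - 2))"
proof -
  obtain p0 where p0: "p0 > 0" and
    main: "\<And>p v v1 v2 v3 v4 a. \<lbrakk>\<And>x. (v has_real_derivative v1 x) (at x);
       \<And>x. (v1 has_real_derivative v2 x) (at x);
       \<And>x. (v2 has_real_derivative v3 x) (at x);
       \<And>x. (v3 has_real_derivative v4 x) (at x);
       \<And>x. v4 x + p * v2 x + \<bar>v x\<bar> powr (r - 2) * v x = 0;
       \<And>x. \<bar>v x\<bar> \<le> 1; \<bar>v a\<bar> \<ge> 1 / 2; p > 0\<rbrakk> \<Longrightarrow> p \<ge> p0"
    using normalized_solution_parameter_bound[OF r] by blast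
  have "sup_norm u \<le> (q / p0) powr (2 / (r - 2))"
    if sol: "is_solution r q u" and bdd: "bounded (range u)" and q: "q > 0" for q u
  proof (cases "sup_norm u = 0")
    case False
    define M where "M = sup_norm u"
    have M: "M > 0" using False sup_norm_nonneg[OF bdd] by (simp add: M_def)
    \<comment> \<open>With this exponent \<open>l ^ 4\<close> cancels the factor
      \<open>M powr (r - 2)\<close> that the nonlinearity produces, and \<open>l ^ 2\<close> is
      \<open>M powr (- ((r - 2) / 2))\<close>.\<close>
    define l where "l = M powr (- (r - 2) / 4)"
    have l: "l > 0" using M by (simp add: l_def)
    have l2: "l ^ 2 = M powr (- ((r - 2) / 2))"
      using M by (simp add: l_def powr_power)
        (auto intro!: arg_cong2[where f = "(powr)"] simp: field_simps)
    have l4: "l ^ 4 = M powr (- (r - 2))"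
      using M by (simp add: l_def powr_power)
        (auto intro!: arg_cong2[where f = "(powr)"] simp: field_simps)
    \<comment> \<open>\<open>w j\<close> is the \<open>j\<close>-th derivative of the normalized
      solution \<open>u (l * x) / M\<close>.\<close>
    define w where "w = (\<lambda>j x. l ^ j * (deriv ^^ j) u (l * x) / M)"
    have w: "(w j has_real_derivative w (Suc j) x) (at x)" if "j < 4" for j x
    proof -
      have "((\<lambda>y. l * y) has_real_derivative l) (at x)"
        by (auto intro!: derivative_eq_intros)
      from DERIV_cdivide[OF DERIV_cmult[OF DERIV_chain2[OF solution_derivs[OF sol that] this]],
          of "l ^ j" M]
      show ?thesis unfolding w_def by (simp add: mult_ac)
    qed
    obtain x0 where x0: "\<bar>u x0\<bar> \<ge> M / 2"
      using half_sup_norm_attained[of u] M by (auto simp: M_def)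
    have "p0 \<le> q * l ^ 2"
    proof (rule main[of "w 0" "w 1" "w 2" "w 3" "w 4" _ "x0 / l"])
      fix x
      have scale: "\<bar>w 0 x\<bar> powr (r - 2) = l ^ 4 * \<bar>u (l * x)\<bar> powr (r - 2)"
        using M unfolding l4 powr_minus by (simp add: w_def abs_divide powr_divide field_simps)
      \<comment> \<open>All three terms scale by the same factor \<open>l ^ 4 / M\<close>; for the
        middle one, \<open>l ^ 2\<close> comes from the parameter and \<open>l ^ 2\<close> from the
        two derivatives.\<close>
      have "w 4 x + q * l ^ 2 * w 2 x + \<bar>w 0 x\<bar> powr (r - 2) * w 0 x =
          l ^ 4 / M * ((deriv ^^ 4) u (l * x) + q * (deriv ^^ 2) u (l * x)
            + \<bar>u (l * x)\<bar> powr (r - 2) * u (l * x))"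
        using M unfolding scale by (simp add: w_def field_simps eval_nat_numeral)
      then show "w 4 x + q * l ^ 2 * w 2 x + \<bar>w 0 x\<bar> powr (r - 2) * w 0 x = 0"
        using sol by (simp add: is_solution_def)
      show "\<bar>w 0 x\<bar> \<le> 1"
        using M abs_le_sup_norm[OF bdd, of "l * x"] by (simp add: w_def M_def)
    next
      show "1 / 2 \<le> \<bar>w 0 (x0 / l)\<bar>" using x0 M l by (simp add: w_def field_simps)
    qed (use w[of 0] w[of 1] w[of 2] w[of 3] q l in \<open>auto simp: eval_nat_numeral\<close>)
    then have "M powr ((r - 2) / 2) \<le> q / p0"
      using p0 M unfolding l2 powr_minus_divide by (simp add: field_simps)
    then have "(M powr ((r - 2) / 2)) powr (2 / (r - 2)) \<le> (q / p0) powr (2 / (r - 2))"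
      using r by (intro powr_mono2) auto
    moreover have "(r - 2) / 2 * (2 / (r - 2)) = 1" using r by simp
    then have "(M powr ((r - 2) / 2)) powr (2 / (r - 2)) = M"
      using M by (simp only: powr_powr powr_one)
    ultimately show ?thesis unfolding M_def by simp
  qed simp
  with p0 that show ?thesis by blast
qed

theorem theorem1p15:
  fixes r :: real and q :: "nat \<Rightarrow> real" and u :: "nat \<Rightarrow> real \<Rightarrow> real"
  assumes "r > 2"
    and "\<And>n. q n > 0"
    and "decseq q"
    and "q \<longlonglongrightarrow> 0"
    and "\<And>n. is_solution r (q n) (u n)"
    and "\<And>n. bounded (range (u n))"
  shows "(\<lambda>n. sup_norm (u n)) \<longlonglongrightarrow> 0"
proof -
  obtain p0 where p0: "p0 > 0" and bound:
    "\<And>q u. is_solution r q u \<Longrightarrow> bounded (range u) \<Longrightarrow> q > 0 \<Longrightarrow>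
       sup_norm u \<le> (q / p0) powr (2 / (r - 2))"
    using sup_norm_solution_bound[OF assms(1)] by blast
  have "(\<lambda>n. q n / p0) \<longlonglongrightarrow> 0"
    using tendsto_divide[OF assms(4) tendsto_const, of p0] p0 by simp
  then have lim: "(\<lambda>n. (q n / p0) powr (2 / (r - 2))) \<longlonglongrightarrow> 0"
    by (rule tendsto_zero_powrI[OF _ tendsto_const])
      (use assms(1) assms(2) p0 in \<open>auto simp: less_imp_le\<close>)
  show ?thesis
    by (rule tendsto_sandwich[OF _ _ tendsto_const lim])
      (use bound assms sup_norm_nonneg in auto)
qed

end
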